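(* There is an absolute constant $C > 0$ such that the following holds. Let $p \in (0,1)$, let $k \ge 1$ be an integer, let $E$ be a finite set, let $\mathcal{D} \subseteq 2^E$ be a nonempty family with $|X| \le k$ for all $X \in \mathcal{D}$, and let $f \colon 2^E \to \mathbb{R}_{\ge 0}$ be a monotone linear or a monotone submodular function. Then for all $\epsilon, \delta \in (0,1)$ there is a query strategy with at most $\left\lceil C \log(1/\min\{\delta,\epsilon\})/(p^2\epsilon) \right\rceil$ rounds that has an approximation factor of \[ \frac{(1-\epsilon)\,p}{1-(1-p)^k} \quad \left( \ge \frac{1-\epsilon}{k} \right) \] with probability at least $1-\delta$.
   Context: Stochastic model: $A \subseteq E$ is a random subset (the active elements) with $e \in A$ with probability $p$ independently for each $e \in E$. $A$ is hidden; querying $e$ reveals whether $e \in A$. A query strategy with $N$ rounds chooses, in each round, a member of $\mathcal{D}$ and queries all its elements, the choice being based only on the answers received in earlier rounds (and possibly randomness independent of $A$). With $Q$ the set of all queried elements, the strategy has an approximation factor of $c$ with probability at least $1-\delta$ if \[ \Pr\left( \max_{X \in \mathcal{D}} f(X \cap A \cap Q) \ge c \max_{Z \in \mathcal{D}} f(Z \cap A) \right) \ge 1-\delta. \] A monotone linear function is $f(X) = \sum_{e \in X} w_e$ with $w_e \ge 0$. *)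

theory Defs
  imports "HOL-Probability.Probability"
begin

definition active_pmf :: "real \<Rightarrow> 'e set \<Rightarrow> 'e set pmf" where
  "active_pmf p E = map_pmf (\<lambda>\<omega>. {e \<in> E. \<omega> e}) (Pi_pmf E False (\<lambda>_. bernoulli_pmf p))"

text \<open>
  One entry \<open>(X, Y)\<close> per past round, oldest first: \<open>X\<close> is the set that was queried and
  \<open>Y = X \<inter> A\<close> is the answer.
\<close>
type_synonym 'e history = "('e set \<times> 'e set) list"

text \<open>
  Strategies are adaptive and randomized. The next set is drawn from a distribution that depends
  on the history alone; its randomness is independent of \<open>A\<close> given the history. Since the
  history records the sets chosen so far, this gives the same joint laws of \<open>A\<close> and history as
  fixing a random seed independent of \<open>A\<close> in advance. Deterministic strategies are the ones
  built from \<^const>\<open>return_pmf\<close>.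
\<close>
type_synonym 'e strategy = "'e history \<Rightarrow> 'e set pmf"

definition query_strategy :: "'e set set \<Rightarrow> 'e strategy \<Rightarrow> bool" where
  "query_strategy D \<sigma> \<longleftrightarrow> (\<forall>h. set_pmf (\<sigma> h) \<subseteq> D)"

primrec run :: "'e strategy \<Rightarrow> 'e set \<Rightarrow> nat \<Rightarrow> 'e history pmf" where
  "run \<sigma> A 0 = return_pmf []"
| "run \<sigma> A (Suc n) =
     bind_pmf (run \<sigma> A n) (\<lambda>h. map_pmf (\<lambda>X. h @ [(X, X \<inter> A)]) (\<sigma> h))"

definition queried :: "'e history \<Rightarrow> 'e set" where
  "queried h = (\<Union>(X, Y) \<in> set h. X)"

definition joint_pmf ::
  "real \<Rightarrow> 'e set \<Rightarrow> 'e strategy \<Rightarrow> nat \<Rightarrow> ('e set \<times> 'e history) pmf" where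
  "joint_pmf p E \<sigma> N = bind_pmf (active_pmf p E) (\<lambda>A. map_pmf (Pair A) (run \<sigma> A N))"

definition approx_factor_with_prob ::
  "real \<Rightarrow> 'e set \<Rightarrow> 'e set set \<Rightarrow> ('e set \<Rightarrow> real) \<Rightarrow> 'e strategy \<Rightarrow> nat \<Rightarrow> real \<Rightarrow> real \<Rightarrow> bool" where
  "approx_factor_with_prob p E D f \<sigma> N c q \<longleftrightarrow>
     measure_pmf.prob (joint_pmf p E \<sigma> N)
       {(A, h). (MAX X\<in>D. f (X \<inter> A \<inter> queried h)) \<ge> c * (MAX Z\<in>D. f (Z \<inter> A))} \<ge> q"

text \<open>Set functions on \<open>Pow E\<close> are total functions whose values outside \<open>Pow E\<close> are irrelevant.\<close>

definition monotone_linear_on :: "'e set \<Rightarrow> ('e set \<Rightarrow> real) \<Rightarrow> bool" where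
  "monotone_linear_on E f \<longleftrightarrow>
     (\<exists>w. (\<forall>e\<in>E. w e \<ge> 0) \<and> (\<forall>X. X \<subseteq> E \<longrightarrow> f X = (\<Sum>e\<in>X. w e)))"

definition monotone_submodular_on :: "'e set \<Rightarrow> ('e set \<Rightarrow> real) \<Rightarrow> bool" where
  "monotone_submodular_on E f \<longleftrightarrow>
     (\<forall>X Y. X \<subseteq> Y \<and> Y \<subseteq> E \<longrightarrow> f X \<le> f Y) \<and>
     (\<forall>X Y. X \<subseteq> E \<and> Y \<subseteq> E \<longrightarrow> f (X \<union> Y) + f (X \<inter> Y) \<le> f X + f Y)"

end

theory Submission
  imports Defs
begin

(* The strategy is optimistic and greedy: with Q the queried elements and B the active ones among
   them, it queries a set X in D that maximizes f (X \<inter> (B \<union> (E - Q))).  This maximum V is an upper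
   bound for the optimum max f (Z \<inter> A).  Put b = f (X \<inter> B) and let m be the number of unqueried
   elements of X.  By submodularity the answer has expected value at least p V + (1 - p) b.  If it
   reaches c V only with probability s, its expected value is at most
   s V + c V (1 - (1 - p)^m) + b (1 - p)^m.  For c = (1 - \<epsilon>) p / (1 - (1 - p)^k) and m > 0 this forces
   s \<ge> \<epsilon> p; for m = 0 the value V has already been found.  Hence N rounds fail with probability at
   most (1 - \<epsilon> p)^N. *)

subsection \<open>Random sets of active elements\<close>

lemma active_pmf_empty [simp]: "active_pmf p {} = return_pmf {}"
  by (simp add: active_pmf_def)

lemma set_active_pmf_subset: "finite E \<Longrightarrow> set_pmf (active_pmf p E) \<subseteq> Pow E"
  by (auto simp: active_pmf_def)

lemma finite_set_active_pmf [simp]: "finite E \<Longrightarrow> finite (set_pmf (active_pmf p E))"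
  by (meson finite_Pow_iff finite_subset set_active_pmf_subset)

lemma integrable_active_pmf [simp]:
  fixes g :: "'e set \<Rightarrow> real"
  shows "finite E \<Longrightarrow> integrable (active_pmf p E) g"
  by (simp add: integrable_measure_pmf_finite)

text \<open>Independence over disjoint ground sets. It allows the answer to the next query to be
  drawn first and the elements that stay unqueried afterwards.\<close>

lemma active_pmf_union:
  assumes "finite U" "finite V" "U \<inter> V = {}"
  shows "active_pmf p (U \<union> V) =
           bind_pmf (active_pmf p U) (\<lambda>A. map_pmf (\<lambda>B. A \<union> B) (active_pmf p V))"
proof -
  have "{e \<in> U \<union> V. if e \<in> U then g e else h e} = {e \<in> U. g e} \<union> {e \<in> V. h e}" for g h
    using assms(3) by auto
  then show ?thesis
    using assms
    by (simp add: active_pmf_def Pi_pmf_union map_pmf_def pair_pmf_def bind_assoc_pmf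
        bind_return_pmf)
qed

lemma active_pmf_insert:
  assumes "finite U" "x \<notin> U"
  shows "active_pmf p (insert x U) =
           bind_pmf (bernoulli_pmf p)
             (\<lambda>b. map_pmf (\<lambda>A. if b then insert x A else A) (active_pmf p U))"
proof -
  have "{e \<in> insert x U. (g(x := b)) e} =
          (if b then insert x {e \<in> U. g e} else {e \<in> U. g e})" for g b
    using assms(2) by auto
  then show ?thesis
    using assms
    by (simp add: active_pmf_def Pi_pmf_insert' map_pmf_def bind_assoc_pmf bind_return_pmf
        del: fun_upd_apply)
qed

lemma expectation_active_pmf_insert:
  fixes g :: "'e set \<Rightarrow> real"
  assumes "finite U" "x \<notin> U" "0 \<le> p" "p \<le> 1"
  shows "measure_pmf.expectation (active_pmf p (insert x U)) g =
           p * measure_pmf.expectation (active_pmf p U) (\<lambda>A. g (insert x A)) +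
           (1 - p) * measure_pmf.expectation (active_pmf p U) g"
  unfolding active_pmf_insert[OF assms(1,2)]
  by (subst pmf_expectation_bind[of UNIV]) (use assms in \<open>auto simp: UNIV_bool\<close>)

lemma prob_active_pmf_empty:
  assumes "finite U" "0 \<le> p" "p \<le> 1"
  shows "measure_pmf.prob (active_pmf p U) {{}} = (1 - p) ^ card U"
  using assms(1)
proof induction
  case (insert x U)
  have "measure_pmf.expectation (active_pmf p (insert x U)) (indicat_real {{}}) =
          (1 - p) * measure_pmf.expectation (active_pmf p U) (indicat_real {{}})"
    using insert.hyps assms expectation_active_pmf_insert[of U x p "indicat_real {{}}"]
    by (simp del: Bochner_Integration.integral_indicator)
  then show ?case
    using insert by simp
qed simp

text \<open>Integrate the pointwise bound \<open>b * indicator S\<close>. With \<open>S\<close> the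
  event that one round falls short, this makes the failure bounds of successive rounds
  multiply.\<close>

lemma measure_bind_pmf_le:
  assumes "\<And>x. x \<in> set_pmf M \<Longrightarrow> x \<in> S \<Longrightarrow> measure_pmf.prob (N x) X \<le> b"
    and "\<And>x. x \<in> set_pmf M \<Longrightarrow> x \<notin> S \<Longrightarrow> measure_pmf.prob (N x) X = 0"
    and "0 \<le> b"
  shows "measure_pmf.prob (bind_pmf M N) X \<le> measure_pmf.prob M S * b"
proof -
  have "emeasure (bind_pmf M N) X = (\<integral>\<^sup>+x. emeasure (N x) X \<partial>M)"
    by simp
  also have "\<dots> \<le> (\<integral>\<^sup>+x. ennreal b * indicator S x \<partial>M)"
    using assms
    by (intro nn_integral_mono_AE)
       (auto simp: AE_measure_pmf_iff measure_pmf.emeasure_eq_measure ennreal_leI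
             split: split_indicator)
  also have "\<dots> = ennreal b * emeasure M S"
    by (simp add: nn_integral_cmult_indicator)
  finally show ?thesis
    using assms(3)
    by (simp add: measure_pmf.emeasure_eq_measure mult.commute flip: ennreal_mult)
qed

subsection \<open>The greedy strategy\<close>

locale submodular_query =
  fixes E :: "'e set" and D :: "'e set set" and f :: "'e set \<Rightarrow> real"
  assumes finite_E: "finite E"
    and D_subset: "D \<subseteq> Pow E"
    and D_nonempty: "D \<noteq> {}"
    and f_nonneg: "X \<subseteq> E \<Longrightarrow> 0 \<le> f X"
    and f_submodular: "monotone_submodular_on E f"
begin

lemma f_mono: "X \<subseteq> Y \<Longrightarrow> Y \<subseteq> E \<Longrightarrow> f X \<le> f Y"
  using f_submodular by (simp add: monotone_submodular_on_def)

lemma f_union_inter: "X \<subseteq> E \<Longrightarrow> Y \<subseteq> E \<Longrightarrow> f (X \<union> Y) + f (X \<inter> Y) \<le> f X + f Y"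
  using f_submodular by (simp add: monotone_submodular_on_def)

lemma finite_D: "finite D"
  using D_subset finite_E by (meson finite_Pow_iff finite_subset)

section \<open>The value of a single query\<close>

lemma expectation_ge:
  assumes "U \<subseteq> E" "S \<subseteq> E" "S \<inter> U = {}" "0 \<le> p" "p \<le> 1"
  shows "p * f (S \<union> U) + (1 - p) * f S
           \<le> measure_pmf.expectation (active_pmf p U) (\<lambda>A. f (S \<union> A))"
proof -
  have "finite U"
    using assms(1) finite_E finite_subset by blast
  then show ?thesis
    using assms(1-3)
  proof (induction arbitrary: S)
    case (insert x U)
    let ?e = "\<lambda>S. measure_pmf.expectation (active_pmf p U) (\<lambda>A. f (S \<union> A))"
    \<comment> \<open>Condition on whether \<open>x\<close> is active. An active \<open>x\<close>
      joins the known part, which is why \<open>S\<close> varies in the induction.\<close>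
    have "p * f (insert x S \<union> U) + (1 - p) * f (insert x S) \<le> ?e (insert x S)"
      using insert by (intro insert.IH) auto
    moreover have "p * f (S \<union> U) + (1 - p) * f S \<le> ?e S"
      using insert by (intro insert.IH) auto
    ultimately have
      "p * (p * f (insert x S \<union> U) + (1 - p) * f (insert x S)) +
       (1 - p) * (p * f (S \<union> U) + (1 - p) * f S) \<le> p * ?e (insert x S) + (1 - p) * ?e S"
      using assms by (intro add_mono mult_left_mono) auto
    also have "\<dots> = measure_pmf.expectation (active_pmf p (insert x U)) (\<lambda>A. f (S \<union> A))"
      using insert.hyps assms by (simp add: expectation_active_pmf_insert)
    finally have step: "p * (p * f (insert x S \<union> U) + (1 - p) * f (insert x S)) +
       (1 - p) * (p * f (S \<union> U) + (1 - p) * f S)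
       \<le> measure_pmf.expectation (active_pmf p (insert x U)) (\<lambda>A. f (S \<union> A))" .
    \<comment> \<open>Diminishing returns: \<open>x\<close> adds at least as much to
      \<open>S\<close> as to \<open>S \<union> U\<close>. Weighted by \<open>p * (1 - p)\<close>,
      this surplus is exactly the difference between the averaged induction hypotheses and the
      claimed bound.\<close>
    have "f (insert x S \<union> (S \<union> U)) + f (insert x S \<inter> (S \<union> U)) \<le> f (insert x S) + f (S \<union> U)"
      using insert.prems by (intro f_union_inter) auto
    moreover have "insert x S \<union> (S \<union> U) = insert x S \<union> U" "insert x S \<inter> (S \<union> U) = S"
      using insert.hyps insert.prems by auto
    ultimately have "0 \<le> p * (1 - p) * (f (insert x S) + f (S \<union> U) - f (insert x S \<union> U) - f S)"
      using assms by (intro mult_nonneg_nonneg) auto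
    then have "p * f (insert x S \<union> U) + (1 - p) * f S \<le>
        p * (p * f (insert x S \<union> U) + (1 - p) * f (insert x S)) +
        (1 - p) * (p * f (S \<union> U) + (1 - p) * f S)"
      by (simp add: algebra_simps)
    with step show ?case
      by simp
  qed (simp add: algebra_simps)
qed

text \<open>The bound for one round: \<open>S\<close> is the part of the query known to be active
  and \<open>U\<close> its unqueried part, so \<open>f (S \<union> U)\<close> is the optimistic
  value. The mean from \<open>expectation_ge\<close> is too large for values of at least
  \<open>c\<close> times this to be rare.\<close>

lemma prob_small_value_le:
  assumes p: "0 < p" "p < 1" and \<epsilon>: "0 < \<epsilon>" "\<epsilon> < 1"
    and S: "S \<subseteq> E" and U: "U \<subseteq> E" "S \<inter> U = {}" "U \<noteq> {}" "card U \<le> k"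
    and c: "c = (1 - \<epsilon>) * p / (1 - (1 - p) ^ k)"
  shows "measure_pmf.prob (active_pmf p U) {A. f (S \<union> A) < c * f (S \<union> U)} \<le> 1 - \<epsilon> * p"
proof -
  define V where "V = f (S \<union> U)"
  define b where "b = f S"
  define m where "m = card U"
  define M where "M = measure_pmf (active_pmf p U)"
  define G where "G = {A. \<not> f (S \<union> A) < c * V}"
  interpret M: prob_space M
    by (simp add: M_def measure_pmf.prob_space_axioms)
  have finU: "finite U"
    using U finite_E finite_subset by blast
  have m: "0 < m" "m \<le> k"
    using U finU by (auto simp: m_def card_gt_0_iff)
  have qk: "0 < 1 - (1 - p) ^ k"
    using p m by (simp add: power_less_one_iff)
  have b: "0 \<le> b" and bV: "b \<le> V"
    using S U by (auto simp: b_def V_def intro!: f_nonneg f_mono)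
  have c0: "0 \<le> c"
    using c qk p \<epsilon> by simp
  have le: "f (S \<union> A) \<le> V" if "A \<subseteq> U" for A
    using that S U by (auto simp: V_def intro!: f_mono)
  have empty: "M.prob {{}} = (1 - p) ^ m"
    using p finU by (simp add: M_def m_def prob_active_pmf_empty)
  have space: "space M = UNIV"
    by (simp add: M_def)
  have int: "integrable M g" for g :: "'e set \<Rightarrow> real"
    using finU by (simp add: M_def)
  have "p * V + (1 - p) * b \<le> M.expectation (\<lambda>A. f (S \<union> A))"
    unfolding M_def V_def b_def using p S U by (intro expectation_ge) auto
  \<comment> \<open>The value is at most \<open>V\<close> on \<open>G\<close>, below
    \<open>c * V\<close> off \<open>G\<close>, and exactly \<open>b\<close> at the empty set.
    Charging \<open>c * V\<close> to every nonempty \<open>A\<close>, even in \<open>G\<close>,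
    leaves only the probabilities of \<open>G\<close> and of the empty set to be known.\<close>
  also have "\<dots> \<le> M.expectation (\<lambda>A. V * indicat_real G A +
      (c * V - (c * V) * indicat_real {{}} A + b * indicat_real {{}} A))"
  proof (rule integral_mono_AE)
    have "f (S \<union> A) \<le> V * indicat_real G A +
        (c * V - (c * V) * indicat_real {{}} A + b * indicat_real {{}} A)" if "A \<subseteq> U" for A
    proof (cases "A = {}")
      case True
      then show ?thesis
        using b bV by (auto simp: b_def split: split_indicator)
    next
      case False
      then show ?thesis
        using le[OF that] mult_nonneg_nonneg[OF c0, of V] b bV
        by (simp add: G_def split: split_indicator)
    qed
    then show "AE A in M. f (S \<union> A) \<le> V * indicat_real G A +
        (c * V - (c * V) * indicat_real {{}} A + b * indicat_real {{}} A)"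
      using set_active_pmf_subset[OF finU] unfolding M_def AE_measure_pmf_iff by blast
  qed (rule int)+
  also have "\<dots> = V * M.prob G + (c * V - c * V * (1 - p) ^ m + b * (1 - p) ^ m)"
    using empty M.prob_space by (simp add: int space)
  finally have main: "p * V + (1 - p) * b \<le>
      V * M.prob G + (c * V - c * V * (1 - p) ^ m + b * (1 - p) ^ m)" .
  \<comment> \<open>As \<open>m\<close> is positive, the contribution of the empty set is absorbed
    by the term \<open>(1 - p) * b\<close> on the left of \<open>main\<close>.\<close>
  have "b * (1 - p) ^ m \<le> (1 - p) * b"
    using b p m power_decreasing[of 1 m "1 - p"] by (simp add: mult.commute mult_left_mono)
  \<comment> \<open>The denominator of \<open>c\<close> cancels here because
    \<open>m \<le> k\<close>. Of the mean \<open>p * V\<close>, the share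
    \<open>\<epsilon> * p * V\<close> must then come from \<open>G\<close>.\<close>
  moreover have "c * V * (1 - (1 - p) ^ m) \<le> (1 - \<epsilon>) * p * V"
  proof -
    have "c * V * (1 - (1 - p) ^ m) \<le> c * V * (1 - (1 - p) ^ k)"
      using c0 b bV p m by (intro mult_left_mono) (auto simp: power_decreasing)
    also have "\<dots> = (1 - \<epsilon>) * p * V"
      using qk by (simp add: c)
    finally show ?thesis .
  qed
  ultimately have G: "V * (\<epsilon> * p) \<le> V * M.prob G"
    using main by (simp add: algebra_simps)
  have "\<epsilon> * p \<le> M.prob G"
  \<comment> \<open>Division by \<open>V\<close> is impossible if it is zero, but then the threshold
    is zero and every outcome reaches it.\<close>
  proof (cases "V = 0")
    case True
    have "0 \<le> f (S \<union> A)" if "A \<subseteq> U" for A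
      using that S U by (intro f_nonneg) auto
    then have "A \<in> G" if "A \<subseteq> U" for A
      using that True by (simp add: G_def not_less)
    then have "AE A in M. A \<in> G"
      using set_active_pmf_subset[OF finU] unfolding M_def AE_measure_pmf_iff by blast
    then have "M.prob G = 1"
      unfolding M_def by (simp add: measure_pmf.prob_eq_1)
    then show ?thesis
      using mult_le_one[of \<epsilon> p] p \<epsilon> by simp
  next
    case False
    then show ?thesis
      using G b bV by simp
  qed
  moreover have "M.prob (space M - G) = 1 - M.prob G"
    by (rule M.prob_compl) (simp add: M_def)
  moreover have "space M - G = {A. f (S \<union> A) < c * V}"
    by (auto simp: M_def G_def)
  ultimately show ?thesis
    by (simp add: M_def V_def)
qed

text \<open>Used for three kinds of argument: at \<open>A\<close> it is the hidden optimum, at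
  \<open>A \<inter> Q\<close> the value found so far, and at \<open>B \<union> (E - Q)\<close> the
  optimistic bound that counts all unqueried elements as active.\<close>

definition best :: "'e set \<Rightarrow> real" where
  "best Y = (MAX X\<in>D. f (X \<inter> Y))"

lemma le_best: "X \<in> D \<Longrightarrow> f (X \<inter> Y) \<le> best Y"
  using finite_D by (simp add: best_def)

lemma best_attained: "\<exists>X\<in>D. f (X \<inter> Y) = best Y"
proof -
  have "best Y \<in> (\<lambda>X. f (X \<inter> Y)) ` D"
    unfolding best_def using finite_D D_nonempty by (intro Max_in) auto
  then show ?thesis
    by auto
qed

lemma best_mono:
  assumes "Y \<inter> E \<subseteq> Z"
  shows "best Y \<le> best Z"
proof -
  obtain X where X: "X \<in> D" "f (X \<inter> Y) = best Y"
    using best_attained by blast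
  then have "f (X \<inter> Y) \<le> f (X \<inter> Z)"
    using assms D_subset by (intro f_mono) auto
  then show ?thesis
    using X le_best[of X Z] by simp
qed

lemma best_nonneg: "0 \<le> best Y"
proof -
  obtain X where "X \<in> D" "f (X \<inter> Y) = best Y"
    using best_attained by blast
  then show ?thesis
    using f_nonneg[of "X \<inter> Y"] D_subset by auto
qed

section \<open>The greedy rule and its failure probability\<close>

definition greedy :: "'e set \<Rightarrow> 'e set \<Rightarrow> 'e set" where
  "greedy Q B = (SOME X. X \<in> D \<and> f (X \<inter> (B \<union> (E - Q))) = best (B \<union> (E - Q)))"

lemma greedy_in_D: "greedy Q B \<in> D"
  and greedy_best: "f (greedy Q B \<inter> (B \<union> (E - Q))) = best (B \<union> (E - Q))"
  using someI_ex[of "\<lambda>X. X \<in> D \<and> f (X \<inter> (B \<union> (E - Q))) = best (B \<union> (E - Q))"] best_attained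
  by (auto simp: greedy_def)

text \<open>For fixed \<open>A\<close> the queried sets form a deterministic orbit of this map. The
  hidden set enters the choice only through \<open>Q \<inter> A\<close>, which is already
  revealed.\<close>

definition greedy_step :: "'e set \<Rightarrow> 'e set \<Rightarrow> 'e set" where
  "greedy_step A Q = Q \<union> greedy Q (Q \<inter> A)"

lemma subset_greedy_steps: "Q \<subseteq> (greedy_step A ^^ n) Q"
  by (induction n) (auto simp: greedy_step_def)

lemma greedy_steps_good:
  assumes "c * best A \<le> best (A \<inter> Q)"
  shows "c * best A \<le> best (A \<inter> (greedy_step A ^^ n) Q)"
  using best_mono[of "A \<inter> Q" "A \<inter> (greedy_step A ^^ n) Q"] subset_greedy_steps[of Q n A] assms
  by force

text \<open>Induction on the rounds from an arbitrary state, with \<open>Q\<close> queried and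
  \<open>B\<close> its active part. Unqueried elements remain independent of past answers, so a
  round leads to a state of the same form.\<close>

lemma prob_greedy_fails_le:
  assumes p: "0 < p" "p < 1" and \<epsilon>: "0 < \<epsilon>" "\<epsilon> < 1"
    and card_le: "\<And>X. X \<in> D \<Longrightarrow> card X \<le> k"
    and c: "c = (1 - \<epsilon>) * p / (1 - (1 - p) ^ k)" "0 \<le> c" "c \<le> 1"
    and Q: "Q \<subseteq> E" "B \<subseteq> Q"
  shows "measure_pmf.prob (active_pmf p (E - Q))
           {A. best ((B \<union> A) \<inter> (greedy_step (B \<union> A) ^^ n) Q) < c * best (B \<union> A)}
         \<le> (1 - \<epsilon> * p) ^ n"
  using Q
proof (induction n arbitrary: Q B)
  case (Suc n)
  \<comment> \<open>The next query \<open>X\<close> has the known active part \<open>S\<close> and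
    reveals \<open>U\<close>; \<open>W\<close> stays hidden. \<open>V\<close> is the optimistic
    bound.\<close>
  define X where "X = greedy Q B"
  define S where "S = X \<inter> B"
  define U where "U = X - Q"
  define V where "V = best (B \<union> (E - Q))"
  define W where "W = E - (Q \<union> X)"
  let ?fail = "\<lambda>n Q A. best (A \<inter> (greedy_step A ^^ n) Q) < c * best A"
  have X: "X \<in> D" "X \<subseteq> E"
    using greedy_in_D[of Q B] D_subset by (auto simp: X_def)
  have fin: "finite U" "finite W"
    using X finite_E finite_subset by (auto simp: U_def W_def)
  have V: "f (S \<union> U) = V"
  proof -
    have "X \<inter> (B \<union> (E - Q)) = S \<union> U"
      using X by (auto simp: S_def U_def)
    then show ?thesis
      using greedy_best[of Q B] by (simp add: X_def V_def)
  qed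
  have E_Q: "E - Q = U \<union> W" "U \<inter> W = {}"
    using X by (auto simp: U_def W_def)
  have step: "greedy_step (B \<union> (A1 \<union> A2)) Q = Q \<union> X" if "A1 \<subseteq> U" "A2 \<subseteq> W" for A1 A2
  proof -
    have "Q \<inter> (B \<union> (A1 \<union> A2)) = B"
      using that Suc.prems by (auto simp: U_def W_def)
    then show ?thesis
      by (simp add: greedy_step_def X_def)
  qed
  \<comment> \<open>\<open>V\<close> bounds the optimum for every hidden set compatible with the
    state. An answer of at least \<open>c * V\<close> is therefore good enough at once, and further
    queries cannot spoil it.\<close>
  have good: "\<not> ?fail n (Q \<union> X) (B \<union> (A1 \<union> A2))"
    if "A1 \<subseteq> U" "A2 \<subseteq> W" "\<not> f (S \<union> A1) < c * V" for A1 A2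
  proof -
    have "c * best (B \<union> (A1 \<union> A2)) \<le> c * V"
      unfolding V_def using that(1,2) c X
      by (intro mult_left_mono best_mono) (auto simp: U_def W_def)
    also have "\<dots> \<le> f (S \<union> A1)"
      using that by simp
    also have "\<dots> \<le> f (X \<inter> ((B \<union> (A1 \<union> A2)) \<inter> (Q \<union> X)))"
      using that(1) X Suc.prems by (intro f_mono) (auto simp: S_def U_def)
    also have "\<dots> \<le> best ((B \<union> (A1 \<union> A2)) \<inter> (Q \<union> X))"
      by (rule le_best) fact
    finally show ?thesis
      using greedy_steps_good by (simp add: not_less)
  qed
  have "measure_pmf.prob (active_pmf p (E - Q)) {A. ?fail (Suc n) Q (B \<union> A)}
        \<le> measure_pmf.prob (active_pmf p U) {A. f (S \<union> A) < c * V} * (1 - \<epsilon> * p) ^ n"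
    unfolding E_Q(1) active_pmf_union[OF fin E_Q(2)]
  proof (rule measure_bind_pmf_le)
    fix A1 assume "A1 \<in> set_pmf (active_pmf p U)"
    then have A1: "A1 \<subseteq> U"
      using set_active_pmf_subset fin by blast
    let ?F = "{A. ?fail (Suc n) Q (B \<union> A)}"
    \<comment> \<open>Splitting off the first round lets the other \<open>n\<close> start from
      \<open>Q \<union> X\<close>. The events are compared only for \<open>A2 \<subseteq> W\<close>,
      which holds almost surely.\<close>
    have F: "measure_pmf.prob (map_pmf ((\<union>) A1) (active_pmf p W)) ?F =
          measure_pmf.prob (active_pmf p W) {A2. ?fail n (Q \<union> X) (B \<union> (A1 \<union> A2))}"
      unfolding measure_map_pmf
    proof (rule measure_pmf.finite_measure_eq_AE)
      show "AE A2 in active_pmf p W. A2 \<in> (\<union>) A1 -` ?F \<longleftrightarrow>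
              A2 \<in> {A2. ?fail n (Q \<union> X) (B \<union> (A1 \<union> A2))}"
        using set_active_pmf_subset[OF fin(2)] step[OF A1]
        by (auto simp: AE_measure_pmf_iff funpow_swap1 subset_iff simp del: funpow.simps(2)
            simp add: funpow_Suc_right)
    qed auto
    have "measure_pmf.prob (active_pmf p (E - (Q \<union> X)))
        {A2. ?fail n (Q \<union> X) ((B \<union> A1) \<union> A2)} \<le> (1 - \<epsilon> * p) ^ n"
      using Suc.prems X A1 by (intro Suc.IH) (auto simp: U_def)
    then show "measure_pmf.prob (map_pmf ((\<union>) A1) (active_pmf p W)) ?F \<le> (1 - \<epsilon> * p) ^ n"
      unfolding F by (simp add: W_def Un_assoc)
    show "measure_pmf.prob (map_pmf ((\<union>) A1) (active_pmf p W)) ?F = 0"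
      if "A1 \<notin> {A. f (S \<union> A) < c * V}"
      unfolding F measure_pmf_zero_iff
      using that good[OF A1] set_active_pmf_subset[OF fin(2)] by blast
  next
    show "0 \<le> (1 - \<epsilon> * p) ^ n"
      using p \<epsilon> mult_le_one[of \<epsilon> p] by simp
  qed
  also have "\<dots> \<le> (1 - \<epsilon> * p) * (1 - \<epsilon> * p) ^ n"
  proof (rule mult_right_mono)
    show "0 \<le> (1 - \<epsilon> * p) ^ n"
      using p \<epsilon> mult_le_one[of \<epsilon> p] by simp
    show "measure_pmf.prob (active_pmf p U) {A. f (S \<union> A) < c * V} \<le> 1 - \<epsilon> * p"
    \<comment> \<open>A query without new elements has the already known value
      \<open>f S = V\<close>; since \<open>c \<le> 1\<close> and \<open>0 \<le> V\<close>, it cannot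
      fall short.\<close>
    proof (cases "U = {}")
      case True
      have "0 \<le> V"
        by (simp add: V_def best_nonneg)
      then have "\<not> f S < c * V"
        using V True c mult_right_mono[of c 1 V] by simp
      then show ?thesis
        using True p \<epsilon> mult_le_one[of \<epsilon> p] by simp
    next
      case False
      have "card U \<le> card X"
        using X finite_E finite_subset by (auto simp: U_def intro!: card_mono)
      then show ?thesis
        unfolding V[symmetric]
        using False X card_le[OF X(1)] c Suc.prems
        by (intro prob_small_value_le[OF p \<epsilon>, where k = k]) (auto simp: S_def U_def)
    qed
  qed
  finally show ?case
    by simp
qed simp

section \<open>The greedy rule as a query strategy\<close>

definition greedy_strategy :: "'e strategy" where
  "greedy_strategy h = return_pmf (greedy (queried h) (\<Union>(X, Y) \<in> set h. Y))"

lemma query_strategy_greedy: "query_strategy D greedy_strategy"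
  by (simp add: query_strategy_def greedy_strategy_def greedy_in_D)

text \<open>The last conjunct carries the induction: the union of the recorded answers, which the
  strategy uses as \<open>B\<close>, is the revealed part of \<open>A\<close>.\<close>

lemma run_greedy:
  "\<exists>h. run greedy_strategy A n = return_pmf h \<and> queried h = (greedy_step A ^^ n) {} \<and>
       (\<Union>(X, Y) \<in> set h. Y) = queried h \<inter> A"
proof (induction n)
  case (Suc n)
  then obtain h where h: "run greedy_strategy A n = return_pmf h"
    "queried h = (greedy_step A ^^ n) {}" "(\<Union>(X, Y) \<in> set h. Y) = queried h \<inter> A"
    by blast
  define X where "X = greedy (queried h) (queried h \<inter> A)"
  have q: "queried (h @ [(X, X \<inter> A)]) = queried h \<union> X"
    by (auto simp: queried_def)
  have "run greedy_strategy A (Suc n) = return_pmf (h @ [(X, X \<inter> A)])"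
    by (simp add: h greedy_strategy_def bind_return_pmf flip: X_def)
       (simp add: h X_def)
  moreover have "queried (h @ [(X, X \<inter> A)]) = (greedy_step A ^^ Suc n) {}"
    unfolding q by (simp add: X_def h greedy_step_def)
  moreover have "(\<Union>(X, Y) \<in> set (h @ [(X, X \<inter> A)]). Y) = queried (h @ [(X, X \<inter> A)]) \<inter> A"
    unfolding q using h(3) by auto
  ultimately show ?case
    by blast
qed (simp add: queried_def)

lemma greedy_approx_factor:
  assumes p: "0 < p" "p < 1" and \<epsilon>: "0 < \<epsilon>" "\<epsilon> < 1"
    and card_le: "\<And>X. X \<in> D \<Longrightarrow> card X \<le> k"
    and c: "c = (1 - \<epsilon>) * p / (1 - (1 - p) ^ k)" "0 \<le> c" "c \<le> 1"
  shows "approx_factor_with_prob p E D f greedy_strategy n c (1 - (1 - \<epsilon> * p) ^ n)"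
proof -
  let ?F = "{A. best (A \<inter> (greedy_step A ^^ n) {}) < c * best A}"
  \<comment> \<open>Each run is a point mass, so choosing its history \<open>H A\<close> turns the
    joint law into an image of the law of \<open>A\<close>.\<close>
  define H where "H A = (SOME h. run greedy_strategy A n = return_pmf h \<and>
    queried h = (greedy_step A ^^ n) {})" for A
  have H: "run greedy_strategy A n = return_pmf (H A)" "queried (H A) = (greedy_step A ^^ n) {}"
    for A
    using someI_ex[of "\<lambda>h. run greedy_strategy A n = return_pmf h \<and>
      queried h = (greedy_step A ^^ n) {}"] run_greedy[of A n] by (auto simp: H_def)
  have joint: "joint_pmf p E greedy_strategy n = map_pmf (\<lambda>A. (A, H A)) (active_pmf p E)"
    by (simp add: joint_pmf_def H map_pmf_def bind_return_pmf)
  have "measure_pmf.prob (active_pmf p E) ?F \<le> (1 - \<epsilon> * p) ^ n"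
    using prob_greedy_fails_le[OF assms, of "{}" "{}" n] by simp
  then have "1 - (1 - \<epsilon> * p) ^ n \<le> measure_pmf.prob (active_pmf p E) (- ?F)"
    using measure_pmf.prob_compl[of ?F "active_pmf p E"] by (simp add: Compl_eq_Diff_UNIV)
  also have "- ?F = (\<lambda>A. (A, H A)) -`
      {(A, h). (MAX X\<in>D. f (X \<inter> A \<inter> queried h)) \<ge> c * (MAX Z\<in>D. f (Z \<inter> A))}"
    by (auto simp: H best_def Int_assoc)
  finally show ?thesis
    by (simp add: approx_factor_with_prob_def joint)
qed

end

subsection \<open>The number of rounds\<close>

lemma monotone_linear_on_imp_submodular:
  assumes "finite E" "monotone_linear_on E f"
  shows "monotone_submodular_on E f"
proof -
  obtain w where w: "\<And>e. e \<in> E \<Longrightarrow> 0 \<le> w e" "\<And>X. X \<subseteq> E \<Longrightarrow> f X = (\<Sum>e\<in>X. w e)"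
    using assms(2) by (auto simp: monotone_linear_on_def)
  have "f X \<le> f Y" if "X \<subseteq> Y" "Y \<subseteq> E" for X Y
    using that w assms(1) by (auto intro!: sum_mono2 intro: finite_subset)
  moreover have "f (X \<union> Y) + f (X \<inter> Y) = f X + f Y" if "X \<subseteq> E" "Y \<subseteq> E" for X Y
  proof -
    have "finite X" "finite Y"
      using that assms(1) finite_subset by auto
    moreover have "X \<inter> Y \<subseteq> E"
      using that by blast
    ultimately show ?thesis
      using that sum.union_inter[of X Y w] by (simp add: w)
  qed
  ultimately show ?thesis
    by (simp add: monotone_submodular_on_def)
qed

lemma approx_factor_with_prob_mono:
  assumes "approx_factor_with_prob p E D f \<sigma> N c q" "q' \<le> q"
  shows "approx_factor_with_prob p E D f \<sigma> N c q'"
  using assms by (simp add: approx_factor_with_prob_def)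

text \<open>Apply \<open>1 + x \<le> exp x\<close> at \<open>x = - (\<epsilon> * p)\<close>. The
  resulting exponent is large enough because
  \<open>p\<^sup>2 * \<epsilon> \<le> \<epsilon> * p\<close>.\<close>

lemma failure_power_le:
  fixes p \<epsilon> \<mu> :: real
  assumes p: "0 < p" "p < 1" and \<epsilon>: "0 < \<epsilon>" "\<epsilon> < 1" and \<mu>: "0 < \<mu>" "\<mu> < 1"
    and N: "ln (1 / \<mu>) / (p\<^sup>2 * \<epsilon>) \<le> real N"
  shows "(1 - \<epsilon> * p) ^ N \<le> \<mu>"
proof -
  have "\<epsilon> * p \<le> 1"
    using p \<epsilon> by (simp add: mult_le_one)
  then have "(1 - \<epsilon> * p) ^ N \<le> exp (- (\<epsilon> * p)) ^ N"
    using exp_ge_add_one_self[of "- (\<epsilon> * p)"] by (intro power_mono) auto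
  also have "\<dots> = exp (- (real N * (\<epsilon> * p)))"
    by (simp flip: exp_of_nat_mult)
  also have "\<dots> \<le> exp (- ln (1 / \<mu>))"
  proof -
    have "ln (1 / \<mu>) \<le> real N * (p\<^sup>2 * \<epsilon>)"
      using N p \<epsilon> by (simp add: pos_divide_le_eq)
    also have "\<dots> \<le> real N * (\<epsilon> * p)"
      using p \<epsilon> by (intro mult_left_mono) (auto simp: power2_eq_square mult_le_cancel_right1)
    finally show ?thesis
      by simp
  qed
  also have "\<dots> = \<mu>"
    using \<mu> by (simp add: ln_div)
  finally show ?thesis .
qed

theorem lemma4p9:
  "\<exists>C::real. C > 0 \<and>
     (\<forall>(p::real) (k::nat) (E::'e set) (D::'e set set) (f::'e set \<Rightarrow> real).
        0 < p \<and> p < 1 \<and> k \<ge> 1 \<and>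
        finite E \<and> D \<subseteq> Pow E \<and> D \<noteq> {} \<and> (\<forall>X\<in>D. card X \<le> k) \<and>
        (\<forall>X. X \<subseteq> E \<longrightarrow> f X \<ge> 0) \<and>
        (monotone_linear_on E f \<or> monotone_submodular_on E f) \<longrightarrow>
        (\<forall>\<epsilon> \<delta>. 0 < \<epsilon> \<and> \<epsilon> < 1 \<and> 0 < \<delta> \<and> \<delta> < 1 \<longrightarrow>
           (1 - \<epsilon>) * p / (1 - (1 - p) ^ k) \<ge> (1 - \<epsilon>) / real k \<and>
           (\<exists>(N::nat) \<sigma>. int N \<le> \<lceil>C * ln (1 / min \<delta> \<epsilon>) / (p\<^sup>2 * \<epsilon>)\<rceil> \<and>
              query_strategy D \<sigma> \<and>
              approx_factor_with_prob p E D f \<sigma> N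
                ((1 - \<epsilon>) * p / (1 - (1 - p) ^ k)) (1 - \<delta>))))"
proof (intro exI[of _ "1::real"] conjI allI impI; (elim conjE)?)
  fix p :: real and k :: nat and E :: "'e set" and D :: "'e set set" and f :: "'e set \<Rightarrow> real"
    and \<epsilon> \<delta> :: real
  assume p: "0 < p" "p < 1" and k: "1 \<le> k" and \<epsilon>: "0 < \<epsilon>" "\<epsilon> < 1"
  have qk: "0 < 1 - (1 - p) ^ k"
    using p k by (simp add: power_less_one_iff)
  \<comment> \<open>Bernoulli's inequality gives the comparison of the factor with
    \<open>(1 - \<epsilon>) / k\<close>.\<close>
  have "1 - (1 - p) ^ k \<le> k * p"
    using Bernoulli_inequality[of "- p" k] p by simp
  then show "(1 - \<epsilon>) / real k \<le> (1 - \<epsilon>) * p / (1 - (1 - p) ^ k)"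
    using qk k \<epsilon> mult_left_mono[of "1 - (1 - p) ^ k" "k * p" "1 - \<epsilon>"]
    by (simp add: divide_le_eq pos_le_divide_eq mult_ac)
  assume "finite E" "D \<subseteq> Pow E" "D \<noteq> {}" and card_le: "\<forall>X\<in>D. card X \<le> k"
    and "\<forall>X. X \<subseteq> E \<longrightarrow> f X \<ge> 0" "monotone_linear_on E f \<or> monotone_submodular_on E f"
    and \<delta>: "0 < \<delta>" "\<delta> < 1"
  then interpret submodular_query E D f
    using monotone_linear_on_imp_submodular[of E f] by unfold_locales auto
  define c where "c = (1 - \<epsilon>) * p / (1 - (1 - p) ^ k)"
  \<comment> \<open>From \<open>k \<ge> 1\<close>; it yields \<open>c \<le> 1\<close>, on which the
    case of a query without new elements rests.\<close>
  have "p \<le> 1 - (1 - p) ^ k"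
    using power_decreasing[of 1 k "1 - p"] p k by simp
  then have "(1 - \<epsilon>) * p \<le> 1 * (1 - (1 - p) ^ k)"
    using p \<epsilon> by (intro mult_mono) auto
  then have c: "0 \<le> c" "c \<le> 1"
    using qk p \<epsilon> by (simp_all add: c_def)
  \<comment> \<open>The leading \<open>1\<close> is the witness for \<open>C\<close>:
    \<open>failure_power_le\<close> asks for no larger constant. Rounding \<open>x\<close> up stays
    within the allowed number of rounds.\<close>
  define x where "x = 1 * ln (1 / min \<delta> \<epsilon>) / (p\<^sup>2 * \<epsilon>)"
  define N where "N = nat \<lceil>x\<rceil>"
  have "0 \<le> x"
    using p \<epsilon> \<delta> by (simp add: x_def)
  then have N: "int N = \<lceil>x\<rceil>"
    by (simp add: N_def)
  then have "x \<le> real N"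
    by (metis le_of_int_ceiling of_int_of_nat_eq)
  then have fail: "(1 - \<epsilon> * p) ^ N \<le> min \<delta> \<epsilon>"
    using p \<epsilon> \<delta> by (intro failure_power_le) (auto simp: x_def)
  have "approx_factor_with_prob p E D f greedy_strategy N c (1 - (1 - \<epsilon> * p) ^ N)"
    using card_le by (intro greedy_approx_factor[OF p \<epsilon> _ c_def c]) blast
  then have "approx_factor_with_prob p E D f greedy_strategy N c (1 - \<delta>)"
    by (rule approx_factor_with_prob_mono) (use fail in linarith)
  then show "\<exists>(N::nat) \<sigma>. int N \<le> \<lceil>1 * ln (1 / min \<delta> \<epsilon>) / (p\<^sup>2 * \<epsilon>)\<rceil> \<and>
      query_strategy D \<sigma> \<and>
      approx_factor_with_prob p E D f \<sigma> N ((1 - \<epsilon>) * p / (1 - (1 - p) ^ k)) (1 - \<delta>)"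
    using N query_strategy_greedy
    by (intro exI[of _ N] exI[of _ greedy_strategy]) (simp add: c_def x_def)
qed simp

end
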